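(* Let $G = \langle s,t : E \to V\rangle$ be a graph. Then $\beta G$ is loop-free if and only if $G$ is finitely colourable.
   Context: A graph $G=\langle s,t:E\to V\rangle$ consists of sets $E$ (edges) and $V$ (vertices) together with two maps $s,t:E\to V$ (source and target); so edges are directed and loops and multiple edges are allowed. For a set $X$, $\beta X$ denotes the set of all ultrafilters on $X$. For a map $f:X\to Y$, the map $\beta f:\beta X\to\beta Y$ is defined by $B\in \beta f(\upsilon)\iff f^{-1}(B)\in\upsilon$ for all $B\subseteq Y$. The graph $\beta G$ is $\langle \beta s,\beta t:\beta E\to\beta V\rangle$, with $\beta E,\beta V$ regarded as plain sets. A graph $\langle s,t:E\to V\rangle$ is loop-free if $s(e)\neq t(e)$ for all $e\in E$. A colouring of $G$ is a map $c:V\to C$ into some set $C$ such that $c(s(e))\ne c(t(e))$ for every $e\in E$; $G$ is finitely colourable if it has a colouring $c:V\to C$ with $C$ finite. *)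

theory Defs
  imports "Graph_Theory.Digraph"
begin

text \<open>
  Graphs are the pre-digraphs of the AFP entry Graph Theory: vertices and edges are carrier sets,
  \<^const>\<open>tail\<close> is the source map \<open>s\<close> and \<^const>\<open>head\<close> is the target map \<open>t\<close>. The locale
  \<^locale>\<open>wf_digraph\<close> only says that these map edges to vertices, so infinite graphs, loops and
  multiple edges are allowed.
\<close>

definition ultrafilter_on :: "'a set \<Rightarrow> 'a set set \<Rightarrow> bool" where
  "ultrafilter_on X U \<longleftrightarrow>
     U \<subseteq> Pow X \<and> X \<in> U \<and> {} \<notin> U \<and>
     (\<forall>A\<in>U. \<forall>B\<in>U. A \<inter> B \<in> U) \<and>
     (\<forall>A\<in>U. \<forall>B. A \<subseteq> B \<and> B \<subseteq> X \<longrightarrow> B \<in> U) \<and>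
     (\<forall>A. A \<subseteq> X \<longrightarrow> A \<in> U \<or> X - A \<in> U)"

definition beta_set :: "'a set \<Rightarrow> 'a set set set" where
  "beta_set X = {U. ultrafilter_on X U}"

text \<open>
  For \<open>f\<close> mapping \<open>X\<close> into \<open>Y\<close>, this is \<open>\<beta>f\<close>. The carriers are explicit because the preimage of
  \<open>B\<close> has to be taken inside \<open>X\<close>, and \<open>B\<close> has to range over the subsets of \<open>Y\<close>.
\<close>

definition beta_map :: "'a set \<Rightarrow> 'b set \<Rightarrow> ('a \<Rightarrow> 'b) \<Rightarrow> 'a set set \<Rightarrow> 'b set set" where
  "beta_map X Y f U = {B. B \<subseteq> Y \<and> f -` B \<inter> X \<in> U}"

definition beta_graph :: "('v, 'e) pre_digraph \<Rightarrow> ('v set set, 'e set set) pre_digraph" where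
  "beta_graph G =
     \<lparr>verts = beta_set (verts G),
      arcs = beta_set (arcs G),
      tail = beta_map (arcs G) (verts G) (tail G),
      head = beta_map (arcs G) (verts G) (head G)\<rparr>"

definition colouring :: "('v, 'e) pre_digraph \<Rightarrow> 'c set \<Rightarrow> ('v \<Rightarrow> 'c) \<Rightarrow> bool" where
  "colouring G C c \<longleftrightarrow>
     (\<forall>v\<in>verts G. c v \<in> C) \<and> (\<forall>e\<in>arcs G. c (tail G e) \<noteq> c (head G e))"

text \<open>
  HOL has no quantification over types, so the finite colour set is taken among the sets of
  natural numbers. Lemma \<open>finitely_colourableI\<close> below shows that this is no restriction.
\<close>

definition finitely_colourable :: "('v, 'e) pre_digraph \<Rightarrow> bool" where
  "finitely_colourable G \<longleftrightarrow> (\<exists>(C :: nat set) c. finite C \<and> colouring G C c)"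

lemma finitely_colourableI:
  fixes C :: "'c set"
  assumes "finite C" and "colouring G C c" and "wf_digraph G"
  shows "finitely_colourable G"
proof -
  interpret wf_digraph G by fact
  obtain g :: "'c \<Rightarrow> nat" where g: "inj_on g C"
    using finite_imp_inj_to_nat_seg[OF assms(1)] by blast
  have "colouring G (g ` C) (g \<circ> c)"
    using assms(2) g unfolding colouring_def by (auto dest: inj_onD)
  with assms(1) show ?thesis
    unfolding finitely_colourable_def by blast
qed

lemma beta_map_in_beta_set:
  assumes "\<And>x. x \<in> X \<Longrightarrow> f x \<in> Y" and "U \<in> beta_set X"
  shows "beta_map X Y f U \<in> beta_set Y"
proof -
  have U: "ultrafilter_on X U"
    using assms(2) by (simp add: beta_set_def)
  have top: "f -` Y \<inter> X = X"
    using assms(1) by auto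
  have inter: "f -` (A \<inter> B) \<inter> X = (f -` A \<inter> X) \<inter> (f -` B \<inter> X)" for A B
    by auto
  have diff: "f -` (Y - A) \<inter> X = X - (f -` A \<inter> X)" for A
    using assms(1) by auto
  have up: "f -` B \<inter> X \<in> U" if "f -` A \<inter> X \<in> U" "A \<subseteq> B" for A B
  proof -
    have "f -` A \<inter> X \<subseteq> f -` B \<inter> X"
      using that(2) by auto
    with that(1) U show ?thesis
      unfolding ultrafilter_on_def by (meson inf_le2)
  qed
  have compl: "f -` A \<inter> X \<in> U \<or> X - (f -` A \<inter> X) \<in> U" for A
    using U unfolding ultrafilter_on_def by (meson inf_le2)
  have "ultrafilter_on Y (beta_map X Y f U)"
    unfolding ultrafilter_on_def
  proof (intro conjI ballI allI impI)
    fix A B assume "A \<in> beta_map X Y f U" "B \<in> beta_map X Y f U"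
    then show "A \<inter> B \<in> beta_map X Y f U"
      using U by (auto simp: beta_map_def inter ultrafilter_on_def simp del: vimage_Int)
  next
    fix A B assume "A \<in> beta_map X Y f U" "A \<subseteq> B \<and> B \<subseteq> Y"
    then show "B \<in> beta_map X Y f U"
      using up by (auto simp: beta_map_def)
  next
    fix A assume "A \<subseteq> Y"
    then show "A \<in> beta_map X Y f U \<or> Y - A \<in> beta_map X Y f U"
      using compl[of A] by (auto simp: beta_map_def diff simp del: vimage_Diff)
  qed (use U top in \<open>auto simp: beta_map_def ultrafilter_on_def\<close>)
  then show ?thesis
    by (simp add: beta_set_def)
qed

lemma wf_digraph_beta_graph:
  assumes "wf_digraph G"
  shows "wf_digraph (beta_graph G)"
proof -
  interpret wf_digraph G by fact
  show ?thesis
    by unfold_locales (simp_all add: beta_graph_def beta_map_in_beta_set)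
qed

end

theory Submission
  imports Defs
begin

text \<open>
  An edge \<open>\<upsilon>\<close> of \<open>\<beta>G\<close> is a loop when \<open>s\<inverse> A \<in> \<upsilon> \<longleftrightarrow> t\<inverse> A \<in> \<upsilon>\<close> for every set \<open>A\<close> of vertices.
  For an ultrafilter this says that, for every \<open>A\<close>, the edges whose two ends lie on the same side
  of \<open>A\<close> form a member of \<open>\<upsilon>\<close>. So \<open>\<beta>G\<close> has a loop precisely when these sets of uncut edges, one
  for each \<open>A\<close>, lie in a common ultrafilter, that is, when they have the finite intersection
  property.

  Failure of this property is finite colourability. If no edge is left uncut by all of finitely
  many sets \<open>A\<^sub>1, \<dots>, A\<^sub>n\<close>, colouring each vertex by the indices \<open>i\<close> with \<open>v \<in> A\<^sub>i\<close> gives the two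
  ends of every edge different colours; at most \<open>2\<^sup>n\<close> colours occur. Conversely, the classes of a
  finite colouring leave no edge uncut: the argument below picks the class in which \<open>\<beta>s \<upsilon>\<close>
  concentrates, and if \<open>\<beta>t \<upsilon>\<close> concentrated there too, some edge would have both ends of that
  colour.

  Beyond this, the only ingredient is the ultrafilter theorem, obtained from Zorn's lemma.
\<close>

section \<open>Ultrafilters on a set\<close>

text \<open>
  Intersecting with \<open>X\<close> makes the empty subfamily say that \<open>X\<close> is nonempty, so no separate
  condition excludes the empty ground set, which carries no ultrafilter.
\<close>

definition finite_intersection_property :: "'a set \<Rightarrow> 'a set set \<Rightarrow> bool" where
  "finite_intersection_property X F \<longleftrightarrow>
     F \<subseteq> Pow X \<and> (\<forall>P. finite P \<longrightarrow> P \<subseteq> F \<longrightarrow> X \<inter> \<Inter>P \<noteq> {})"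

lemma maximal_finite_intersection_property:
  assumes "finite_intersection_property X F"
  obtains M where "F \<subseteq> M" "finite_intersection_property X M"
    "\<And>N. finite_intersection_property X N \<Longrightarrow> M \<subseteq> N \<Longrightarrow> N = M"
proof -
  let ?S = "{M. F \<subseteq> M \<and> finite_intersection_property X M}"
  have "\<exists>M\<in>?S. \<forall>N\<in>?S. M \<subseteq> N \<longrightarrow> N = M"
  proof (rule subset_Zorn_nonempty)
    show "?S \<noteq> {}"
      using assms by blast
  next
    fix C assume C: "C \<noteq> {}" "subset.chain ?S C"
    then have mem: "F \<subseteq> M" "finite_intersection_property X M" if "M \<in> C" for M
      using that by (auto simp: subset.chain_def)
    have "X \<inter> \<Inter>P \<noteq> {}" if P: "finite P" "P \<subseteq> \<Union>C" for P
    proof -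
      \<comment> \<open>In a chain, finitely many members of the union already occur in one link.\<close>
      obtain M where "M \<in> C" "P \<subseteq> M"
        using finite_subset_Union_chain[OF P C] by blast
      then show ?thesis
        using mem(2) P(1) by (auto simp: finite_intersection_property_def)
    qed
    moreover have "\<Union>C \<subseteq> Pow X"
      using mem(2) by (auto simp: finite_intersection_property_def)
    moreover have "F \<subseteq> \<Union>C"
      using mem(1) C(1) by blast
    ultimately show "\<Union>C \<in> ?S"
      by (simp add: finite_intersection_property_def)
  qed
  then obtain M where "M \<in> ?S" and max: "\<forall>N\<in>?S. M \<subseteq> N \<longrightarrow> N = M"
    by (rule bexE)
  then have M: "F \<subseteq> M" "finite_intersection_property X M"
    by simp_all
  show ?thesis
  proof (rule that[OF M])
    fix N assume "finite_intersection_property X N" "M \<subseteq> N"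
    then show "N = M"
      using max M(1) by simp
  qed
qed

text \<open>
  A maximal family with the finite intersection property contains every set that meets all its
  finite intersections, because adding such a set preserves the property. Each ultrafilter axiom
  is an instance of this.
\<close>

lemma finite_intersection_property_extends_to_ultrafilter:
  assumes "finite_intersection_property X F"
  obtains U where "U \<in> beta_set X" "F \<subseteq> U"
proof -
  obtain M where FM: "F \<subseteq> M" and M: "finite_intersection_property X M"
    and max: "\<And>N. finite_intersection_property X N \<Longrightarrow> M \<subseteq> N \<Longrightarrow> N = M"
    using maximal_finite_intersection_property[OF assms] by blast
  have sub: "M \<subseteq> Pow X"
    using M by (simp add: finite_intersection_property_def)
  have fip: "X \<inter> \<Inter>P \<noteq> {}" if "finite P" "P \<subseteq> M" for P
    using M that by (simp add: finite_intersection_property_def)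
  have meets: "A \<in> M"
    if A: "A \<subseteq> X" and meet: "\<And>P. finite P \<Longrightarrow> P \<subseteq> M \<Longrightarrow> X \<inter> (A \<inter> \<Inter>P) \<noteq> {}" for A
  proof -
    have "X \<inter> \<Inter>P \<noteq> {}" if "finite P" "P \<subseteq> insert A M" for P
    proof -
      have "X \<inter> (A \<inter> \<Inter>(P - {A})) \<noteq> {}"
        using that by (intro meet) auto
      then show ?thesis
        by blast
    qed
    then have "finite_intersection_property X (insert A M)"
      using A sub by (auto simp: finite_intersection_property_def)
    then show ?thesis
      using max by blast
  qed
  have "ultrafilter_on X M"
    unfolding ultrafilter_on_def
  proof (intro conjI ballI allI impI)
    show "M \<subseteq> Pow X"
      by (fact sub)
    show "X \<in> M"
      using fip by (intro meets) auto
    show "{} \<notin> M"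
      using fip[of "{{}}"] by auto
  next
    fix A B assume AB: "A \<in> M" "B \<in> M"
    show "A \<inter> B \<in> M"
    proof (rule meets)
      show "A \<inter> B \<subseteq> X"
        using AB sub by auto
      fix P assume "finite P" "P \<subseteq> M"
      then show "X \<inter> (A \<inter> B \<inter> \<Inter>P) \<noteq> {}"
        using fip[of "insert A (insert B P)"] AB by (simp add: Int_assoc)
    qed
  next
    fix A B assume AB: "A \<in> M" "A \<subseteq> B \<and> B \<subseteq> X"
    show "B \<in> M"
    proof (rule meets)
      show "B \<subseteq> X"
        using AB by simp
      fix P assume "finite P" "P \<subseteq> M"
      then have "X \<inter> \<Inter>(insert A P) \<noteq> {}"
        using AB by (intro fip) auto
      then show "X \<inter> (B \<inter> \<Inter>P) \<noteq> {}"
        using AB by auto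
    qed
  next
    fix A assume A: "A \<subseteq> X"
    show "A \<in> M \<or> X - A \<in> M"
    proof (rule ccontr)
      assume "\<not> (A \<in> M \<or> X - A \<in> M)"
      then obtain P Q where P: "finite P" "P \<subseteq> M" "X \<inter> (A \<inter> \<Inter>P) = {}"
        and Q: "finite Q" "Q \<subseteq> M" "X \<inter> ((X - A) \<inter> \<Inter>Q) = {}"
        using meets[of A] meets[of "X - A"] A by (meson Diff_subset)
      have "X \<inter> \<Inter>(P \<union> Q) \<noteq> {}"
        using P Q by (intro fip) auto
      with P(3) Q(3) show False
        by auto
    qed
  qed
  then show ?thesis
    using that FM by (simp add: beta_set_def)
qed

text \<open>
  Otherwise all the complements would belong to the ultrafilter, and so would their finite
  intersection, which is empty.
\<close>

lemma ultrafilter_on_finite_cover: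
  assumes U: "ultrafilter_on X U" and "finite I" and "X \<subseteq> (\<Union>i\<in>I. A i)"
  obtains i where "i \<in> I" "A i \<inter> X \<in> U"
proof -
  have "X - (\<Union>i\<in>I. A i) \<in> U" if none: "\<forall>i\<in>I. A i \<inter> X \<notin> U"
    using \<open>finite I\<close> none
  proof (induction I)
    case empty
    then show ?case
      using U by (simp add: ultrafilter_on_def)
  next
    case (insert i I)
    have "X - A i \<inter> X \<in> U"
      using U insert.prems unfolding ultrafilter_on_def by (meson inf_le2 insertI1)
    moreover have "X - (\<Union>j\<in>I. A j) \<in> U"
      using insert by simp
    ultimately have "(X - A i \<inter> X) \<inter> (X - (\<Union>j\<in>I. A j)) \<in> U"
      using U by (simp add: ultrafilter_on_def)
    moreover have "(X - A i \<inter> X) \<inter> (X - (\<Union>j\<in>I. A j)) = X - (\<Union>j\<in>insert i I. A j)"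
      by auto
    ultimately show ?case
      by simp
  qed
  moreover have "X - (\<Union>i\<in>I. A i) \<notin> U"
    using assms(3) U by (simp add: ultrafilter_on_def Diff_eq_empty_iff[THEN iffD2])
  ultimately show ?thesis
    using that by blast
qed

section \<open>Loops and uncut edges\<close>

definition uncut_arcs :: "('v, 'e) pre_digraph \<Rightarrow> 'v set \<Rightarrow> 'e set" where
  "uncut_arcs G A = {e \<in> arcs G. tail G e \<in> A \<longleftrightarrow> head G e \<in> A}"

text \<open>
  The two preimages of \<open>A\<close> have the same trace on the uncut edges, so an ultrafilter that contains
  the uncut edges cannot tell them apart.
\<close>

lemma beta_tail_eq_beta_head:
  assumes U: "ultrafilter_on (arcs G) U"
    and uncut: "\<And>A. A \<subseteq> verts G \<Longrightarrow> uncut_arcs G A \<in> U"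
  shows "beta_map (arcs G) (verts G) (tail G) U = beta_map (arcs G) (verts G) (head G) U"
proof -
  have transfer: "g -` A \<inter> arcs G \<in> U"
    if "A \<subseteq> verts G" "f -` A \<inter> arcs G \<in> U"
      and "f -` A \<inter> uncut_arcs G A \<subseteq> g -` A" for A f g
  proof -
    have "(f -` A \<inter> arcs G) \<inter> uncut_arcs G A \<in> U"
      using U uncut that(1,2) by (simp add: ultrafilter_on_def)
    moreover have "(f -` A \<inter> arcs G) \<inter> uncut_arcs G A \<subseteq> g -` A \<inter> arcs G"
      using that(3) by auto
    ultimately show ?thesis
      using U unfolding ultrafilter_on_def by (meson inf_le2)
  qed
  have "tail G -` A \<inter> arcs G \<in> U \<longleftrightarrow> head G -` A \<inter> arcs G \<in> U" if "A \<subseteq> verts G" for A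
  proof
    show "head G -` A \<inter> arcs G \<in> U" if "tail G -` A \<inter> arcs G \<in> U"
      using \<open>A \<subseteq> verts G\<close> that by (rule transfer) (auto simp: uncut_arcs_def)
    show "tail G -` A \<inter> arcs G \<in> U" if "head G -` A \<inter> arcs G \<in> U"
      using \<open>A \<subseteq> verts G\<close> that by (rule transfer) (auto simp: uncut_arcs_def)
  qed
  then show ?thesis
    by (auto simp: beta_map_def)
qed

text \<open>
  The colour of a vertex is the set of those \<open>A\<close> in the finite family that contain it; some member
  of the family separates the ends of each edge, hence separates their colours.
\<close>

lemma finitely_colourable_if_all_arcs_cut:
  assumes "wf_digraph G" and "finite Q" and "arcs G \<inter> (\<Inter>A\<in>Q. uncut_arcs G A) = {}"
  shows "finitely_colourable G"
proof (rule finitely_colourableI)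
  show "finite (Pow Q)"
    using assms(2) by simp
  show "colouring G (Pow Q) (\<lambda>v. {A \<in> Q. v \<in> A})"
    using assms(3) by (fastforce simp: colouring_def uncut_arcs_def)
qed fact

lemma finitely_colourable_if_loopfree_beta_graph:
  assumes G: "wf_digraph G" and loopfree: "loopfree_digraph (beta_graph G)"
  shows "finitely_colourable G"
proof (rule ccontr)
  assume not_colourable: "\<not> finitely_colourable G"
  have "arcs G \<inter> \<Inter>P \<noteq> {}" if P: "finite P" "P \<subseteq> uncut_arcs G ` Pow (verts G)" for P
  proof -
    obtain Q where "finite Q" "P = uncut_arcs G ` Q"
      using finite_subset_image[OF P] by blast
    then show ?thesis
      using finitely_colourable_if_all_arcs_cut[OF G] not_colourable by blast
  qed
  then have "finite_intersection_property (arcs G) (uncut_arcs G ` Pow (verts G))"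
    by (auto simp: finite_intersection_property_def uncut_arcs_def)
  then obtain U where U: "U \<in> beta_set (arcs G)" "uncut_arcs G ` Pow (verts G) \<subseteq> U"
    by (rule finite_intersection_property_extends_to_ultrafilter)
  then have "tail (beta_graph G) U = head (beta_graph G) U"
    using beta_tail_eq_beta_head[of G U] by (auto simp: beta_graph_def beta_set_def)
  moreover have "U \<in> arcs (beta_graph G)"
    using U by (simp add: beta_graph_def)
  ultimately show False
    using loopfree_digraph.no_loops[OF loopfree] by blast
qed

lemma loopfree_beta_graph_if_finitely_colourable:
  assumes G: "wf_digraph G" and "finitely_colourable G"
  shows "loopfree_digraph (beta_graph G)"
proof -
  obtain C :: "nat set" and c where C: "finite C" and c: "colouring G C c"
    using assms(2) unfolding finitely_colourable_def by blast
  have tail_in: "tail G e \<in> verts G" if "e \<in> arcs G" for e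
    using G that by (simp add: wf_digraph.tail_in_verts)
  have "tail (beta_graph G) U \<noteq> head (beta_graph G) U" if "U \<in> arcs (beta_graph G)" for U
  proof
    assume loop: "tail (beta_graph G) U = head (beta_graph G) U"
    have U: "ultrafilter_on (arcs G) U"
      using that by (simp add: beta_graph_def beta_set_def)
    define colour_class where "colour_class i = {v \<in> verts G. c v = i}" for i
    have "arcs G \<subseteq> (\<Union>i\<in>C. tail G -` colour_class i)"
      using c tail_in by (auto simp: colouring_def colour_class_def)
    then obtain i where i: "tail G -` colour_class i \<inter> arcs G \<in> U"
      using ultrafilter_on_finite_cover[OF U C, of "\<lambda>i. tail G -` colour_class i"] by blast
    then have "colour_class i \<in> tail (beta_graph G) U"
      by (auto simp: beta_graph_def beta_map_def colour_class_def)
    then have "head G -` colour_class i \<inter> arcs G \<in> U"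
      unfolding loop by (simp add: beta_graph_def beta_map_def)
    with i have "(tail G -` colour_class i \<inter> arcs G) \<inter> (head G -` colour_class i \<inter> arcs G) \<in> U"
      using U by (simp add: ultrafilter_on_def)
    moreover have "(tail G -` colour_class i \<inter> arcs G) \<inter> (head G -` colour_class i \<inter> arcs G) = {}"
      using c by (auto simp: colouring_def colour_class_def)
    ultimately show False
      using U by (simp add: ultrafilter_on_def)
  qed
  then show ?thesis
    using wf_digraph_beta_graph[OF G]
    by (simp add: loopfree_digraph_def loopfree_digraph_axioms_def)
qed

theorem theorem2:
  fixes G :: "('v, 'e) pre_digraph"
  assumes "wf_digraph G"
  shows "loopfree_digraph (beta_graph G) \<longleftrightarrow> finitely_colourable G"
proof
  show "finitely_colourable G" if "loopfree_digraph (beta_graph G)"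
    using assms that by (rule finitely_colourable_if_loopfree_beta_graph)
  show "loopfree_digraph (beta_graph G)" if "finitely_colourable G"
    using assms that by (rule loopfree_beta_graph_if_finitely_colourable)
qed

end
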